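(* Let $\pi$ be an $n$-dimensional subspace of $\mathrm{PG}(2n+1,q^{2})$. Denote by $v_{\pi}$ the incidence vector of $\pi\cap\mathcal{H}(2n+1,q^{2})$ and by $v_{\pi^{\sigma}}$ the incidence vector of $\pi^{\sigma}\cap\mathcal{H}(2n+1,q^{2})$. Then for every $\alpha\in\mathbb{F}_{p}$, $\alpha(v_{\pi}-v_{\pi^{\sigma}})$ is a code word of $C_{n}(\mathcal{H}(2n+1,q^{2}))^{\perp}$.
   Context: $q$ is a power of the prime $p$. $\mathcal{H}(2n+1,q^2)$ is the non-singular Hermitian variety $X_0^{q+1}+\dots+X_{2n+1}^{q+1}=0$ in $\mathrm{PG}(2n+1,q^2)$ with associated Hermitian polarity $\sigma$; generators are the $n$-dimensional subspaces contained in it. $C_{n}(\mathcal{H}(2n+1,q^{2}))^{\perp}$ is the set of vectors $c\in\mathbb{F}_p^{\mathcal{P}}$ ($\mathcal{P}$ the point set of the variety) with $\sum_{P\in\mu}c_P=0$ for every generator $\mu$. Incidence vectors are taken in $\mathbb{F}_p^{\mathcal{P}}$. *)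

theory Defs
  imports "HOL-Analysis.Analysis"
begin

text \<open>
  The projective space over a finite field \<open>'k\<close> with homogeneous coordinates indexed by a finite
  type \<open>'m\<close> has projective dimension \<open>CARD('m) - 1\<close>. A point is a one-dimensional linear subspace
  of \<open>'k ^ 'm\<close>, and a projective subspace is identified with the set of points on it.
\<close>

definition pg_points :: "('k::{field,finite} ^ 'm::finite) set set" where
  "pg_points = {P. vec.subspace P \<and> vec.dim P = 1}"

text \<open>A subspace of projective dimension \<open>d\<close> comes from a linear subspace of dimension \<open>d + 1\<close>.\<close>

definition pg_subspaces :: "nat \<Rightarrow> ('k::{field,finite} ^ 'm::finite) set set set" where
  "pg_subspaces d =
    {{P \<in> pg_points. P \<subseteq> U} | U. vec.subspace U \<and> vec.dim U = d + 1}"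

definition hermitian_variety :: "nat \<Rightarrow> ('k::{field,finite} ^ 'm::finite) set set" where
  "hermitian_variety q = {P \<in> pg_points. \<forall>x\<in>P. (\<Sum>i\<in>UNIV. (x $ i) ^ (q + 1)) = 0}"

text \<open>
  The Hermitian polarity maps the point with coordinates \<open>y\<close> to the hyperplane
  \<open>\<Sum>i. X\<^sub>i * y\<^sub>i ^ q = 0\<close>, and a subspace to the intersection of the hyperplanes of its points.
\<close>

definition hermitian_polarity ::
    "nat \<Rightarrow> ('k::{field,finite} ^ 'm::finite) set set \<Rightarrow> ('k ^ 'm) set set" where
  "hermitian_polarity q S =
    {P \<in> pg_points. \<forall>Q\<in>S. \<forall>x\<in>P. \<forall>y\<in>Q. (\<Sum>i\<in>UNIV. x $ i * (y $ i) ^ q) = 0}"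

definition hermitian_generators ::
    "nat \<Rightarrow> nat \<Rightarrow> ('k::{field,finite} ^ 'm::finite) set set set" where
  "hermitian_generators n q = {\<mu> \<in> pg_subspaces n. \<mu> \<subseteq> hermitian_variety q}"

text \<open>
  Vectors indexed by the points of the variety are represented as functions that vanish outside
  the variety. The entries lie in \<open>'f\<close>, the field with \<open>p\<close> elements.
\<close>

definition hermitian_dual_code ::
    "nat \<Rightarrow> nat \<Rightarrow> (('k::{field,finite} ^ 'm::finite) set \<Rightarrow> 'f::{field,finite}) set" where
  "hermitian_dual_code n q =
    {c. (\<forall>P. P \<notin> hermitian_variety q \<longrightarrow> c P = 0) \<and>
        (\<forall>\<mu> \<in> hermitian_generators n q. (\<Sum>P\<in>\<mu>. c P) = 0)}"

definition incidence_vector ::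
    "nat \<Rightarrow> ('k::{field,finite} ^ 'm::finite) set set \<Rightarrow> ('k ^ 'm) set \<Rightarrow> 'f::{field,finite}" where
  "incidence_vector q S = indicator (S \<inter> hermitian_variety q)"

end

theory Submission
  imports Defs "HOL-Computational_Algebra.Polynomial" "HOL-Number_Theory.Residues"
begin

text \<open>
  Let \<open>U\<close> and \<open>M\<close> be the linear subspaces of dimension \<open>n + 1\<close> that carry \<open>\<pi>\<close> and a generator.
  The Hermitian form vanishes on \<open>M\<close>, and \<open>M\<close> has half the dimension of the whole space, so
  \<open>M\<^sup>\<bottom> = M\<close>. Hence \<open>M \<inter> U\<^sup>\<bottom> = (M + U)\<^sup>\<bottom>\<close> has dimension
  \<open>2 * (n + 1) - dim (M + U) = dim (M \<inter> U)\<close>. The generator therefore meets \<open>\<pi>\<close> and its polar space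
  in the same number of points.
\<close>

text \<open>On the diagonal this is the equation of the variety, as
  \<open>x * x ^ q = x ^ (q + 1)\<close>.\<close>

definition hermitian_form :: "nat \<Rightarrow> 'k::field ^ 'm::finite \<Rightarrow> 'k ^ 'm \<Rightarrow> 'k" where
  "hermitian_form q x y = (\<Sum>i\<in>UNIV. x $ i * (y $ i) ^ q)"

text \<open>The left orthogonal, as in \<open>hermitian_polarity\<close>: its conditions are linear
  in the unknown, so it is a subspace for any set \<open>A\<close>.\<close>

definition hermitian_perp :: "nat \<Rightarrow> ('k::field ^ 'm::finite) set \<Rightarrow> ('k ^ 'm) set" where
  "hermitian_perp q A = {x. \<forall>y\<in>A. hermitian_form q x y = 0}"

definition points_on :: "('k::{field,finite} ^ 'm::finite) set \<Rightarrow> ('k ^ 'm) set set" where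
  "points_on U = {P \<in> pg_points. P \<subseteq> U}"

text \<open>The characteristic is a prime dividing the order \<open>p ^ d\<close>, hence equals
  \<open>p\<close>, and the freshman's dream applies.\<close>

lemma frobenius_power_add:
  fixes x y :: "'k::{field,finite}"
  assumes "prime p" and "CARD('k) = p ^ d"
  shows "(x + y) ^ (p ^ e) = x ^ (p ^ e) + y ^ (p ^ e)"
proof -
  have "prime CHAR('k)"
    by (intro prime_CHAR_semidom finite_imp_CHAR_pos) simp
  moreover have "CHAR('k) dvd p ^ d"
    using CHAR_dvd_CARD[where 'a = 'k] assms by simp
  ultimately have "CHAR('k) = p"
    using assms(1) by (meson prime_dvd_power primes_dvd_imp_eq)
  then show ?thesis
    using assms(1) by (intro freshmans_dream') auto
qed

lemma hermitian_form_add_left: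
  "hermitian_form q (x + x') y = hermitian_form q x y + hermitian_form q x' y"
  by (simp add: hermitian_form_def algebra_simps sum.distrib)

lemma hermitian_form_scale_left: "hermitian_form q (a *s x) y = a * hermitian_form q x y"
  by (simp add: hermitian_form_def algebra_simps sum_distrib_left)

lemma hermitian_form_scale_right: "hermitian_form q x (a *s y) = a ^ q * hermitian_form q x y"
  by (simp add: hermitian_form_def algebra_simps sum_distrib_left power_mult_distrib)

lemma hermitian_form_zero_left [simp]: "hermitian_form q 0 y = 0"
  by (simp add: hermitian_form_def)

lemma hermitian_form_zero_right: "q > 0 \<Longrightarrow> hermitian_form q x 0 = 0"
  by (simp add: hermitian_form_def zero_power)

lemma hermitian_form_add_right:
  fixes x :: "'k::field ^ 'm::finite"
  assumes "\<And>a b :: 'k. (a + b) ^ q = a ^ q + b ^ q"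
  shows "hermitian_form q x (y + y') = hermitian_form q x y + hermitian_form q x y'"
  by (simp add: hermitian_form_def assms distrib_left sum.distrib)

section \<open>Orthogonal subspaces and their dimensions\<close>

lemma subspace_hermitian_perp: "vec.subspace (hermitian_perp q A)"
  unfolding vec.subspace_def hermitian_perp_def
  by (auto simp: hermitian_form_add_left hermitian_form_scale_left)

text \<open>Additivity of the \<open>q\<close>-th power makes the form semilinear in its second
  argument, so the vectors orthogonal to a fixed \<open>x\<close> are closed under linear
  combinations.\<close>

lemma hermitian_perp_span:
  fixes A :: "('k::field ^ 'm::finite) set"
  assumes "q > 0" and "\<And>a b :: 'k. (a + b) ^ q = a ^ q + b ^ q"
  shows "hermitian_perp q (vec.span A) = hermitian_perp q A"
proof
  show "hermitian_perp q (vec.span A) \<subseteq> hermitian_perp q A"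
    unfolding hermitian_perp_def using vec.span_base by blast
  have "hermitian_form q x y = 0"
    if "y \<in> vec.span A" and "x \<in> hermitian_perp q A" for x y
    using that
    by (induction rule: vec.span_induct_alt)
      (auto simp: hermitian_form_zero_right hermitian_form_add_right hermitian_form_scale_right
        hermitian_perp_def assms)
  then show "hermitian_perp q A \<subseteq> hermitian_perp q (vec.span A)"
    unfolding hermitian_perp_def[of q "vec.span A"] by blast
qed

text \<open>Nondegeneracy: pairing with the unit vectors reads off the coordinates.\<close>

lemma hermitian_perp_UNIV:
  assumes "q > 0"
  shows "hermitian_perp q (UNIV :: ('k::field ^ 'm::finite) set) = {0}"
proof
  show "hermitian_perp q UNIV \<subseteq> {0 :: 'k ^ 'm}"
  proof
    fix x :: "'k ^ 'm"
    assume "x \<in> hermitian_perp q UNIV"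
    then have "hermitian_form q x (axis j 1) = 0" for j
      by (auto simp: hermitian_perp_def)
    moreover have "hermitian_form q x (axis j 1) = x $ j" for j
    proof -
      have "hermitian_form q x (axis j 1) = (\<Sum>i\<in>UNIV. if i = j then x $ i else 0)"
        unfolding hermitian_form_def using assms by (intro sum.cong) (auto simp: axis_def)
      then show ?thesis by simp
    qed
    ultimately show "x \<in> {0}" by (simp add: vec_eq_iff)
  qed
qed (simp add: hermitian_perp_def)

text \<open>Pairing with \<open>b\<close> is a linear functional, and its kernel has codimension at
  most one.\<close>

lemma dim_hermitian_perp_insert:
  "vec.dim (hermitian_perp q A) \<le> vec.dim (hermitian_perp q (insert b A)) + 1"
proof (cases "hermitian_perp q A \<subseteq> hermitian_perp q (insert b A)")
  case True
  then show ?thesis by (meson vec.dim_subset trans_le_add1)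
next
  case False
  let ?K = "hermitian_perp q (insert b A)"
  from False obtain v where v: "v \<in> hermitian_perp q A" "hermitian_form q v b \<noteq> 0"
    by (auto simp: hermitian_perp_def)
  have "hermitian_perp q A \<subseteq> vec.span (insert v ?K)"
  proof
    fix x assume x: "x \<in> hermitian_perp q A"
    \<comment> \<open>This multiple of \<open>v\<close> moves \<open>x\<close> into the kernel of
      the pairing with \<open>b\<close>.\<close>
    define a where "a = - (hermitian_form q x b / hermitian_form q v b)"
    have "hermitian_form q x b + a * hermitian_form q v b = 0"
      using v(2) by (simp add: a_def)
    then have "x + a *s v \<in> ?K"
      using x v(1)
      by (simp add: hermitian_perp_def hermitian_form_add_left hermitian_form_scale_left)
    then have "(x + a *s v) - a *s v \<in> vec.span (insert v ?K)"
      by (intro vec.span_diff vec.span_scale vec.span_base) auto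
    then show "x \<in> vec.span (insert v ?K)" by simp
  qed
  then have "vec.dim (hermitian_perp q A) \<le> vec.dim (insert v ?K)"
    by (rule vec.dim_mono)
  also have "\<dots> \<le> vec.dim ?K + 1"
    by (simp add: vec.dim_insert)
  finally show ?thesis .
qed

lemma dim_hermitian_perp_ge:
  fixes A :: "('k::field ^ 'm::finite) set"
  assumes "finite A"
  shows "CARD('m) \<le> vec.dim (hermitian_perp q A) + card A"
  using assms
proof induction
  case empty
  show ?case by (simp add: hermitian_perp_def card_cart_basis)
next
  case (insert b A)
  then show ?case using dim_hermitian_perp_insert[of q A b] by simp
qed

lemma dim_sum_le_CARD:
  fixes S T :: "('k::field ^ 'm::finite) set"
  assumes "vec.subspace S" and "vec.subspace T" and "S \<inter> T \<subseteq> {0}"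
  shows "vec.dim S + vec.dim T \<le> CARD('m)"
proof -
  have "vec.dim (S \<inter> T) = 0" using assms(3) by (simp only: vec.dim_eq_0)
  then have "vec.dim S + vec.dim T = vec.dim {x + y |x y. x \<in> S \<and> y \<in> T}"
    using vec.dim_sums_Int[OF assms(1,2)] by presburger
  also have "\<dots> \<le> CARD('m)"
    using vec.dim_subset[OF subset_UNIV] by (simp add: card_cart_basis)
  finally show ?thesis .
qed

text \<open>A basis \<open>B\<close> of \<open>U\<close> is extended to a basis \<open>B'\<close> of
  the whole space. The orthogonals of \<open>B\<close> and of \<open>B' - B\<close> meet only in 0
  by nondegeneracy, so their dimensions add up to at most \<open>CARD('m)\<close>. The lower bounds
  from \<open>dim_hermitian_perp_ge\<close> already add up to \<open>CARD('m)\<close>, so both are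
  attained.\<close>

lemma dim_hermitian_perp:
  fixes U :: "('k::field ^ 'm::finite) set"
  assumes "q > 0" and "\<And>a b :: 'k. (a + b) ^ q = a ^ q + b ^ q"
    and "vec.subspace U"
  shows "vec.dim (hermitian_perp q U) + vec.dim U = CARD('m)"
proof -
  obtain B where B: "finite B" "vec.independent B" "vec.span B = U" "card B = vec.dim U"
    using vec.basis_subspace_exists[OF assms(3)] by metis
  obtain B' where B': "B \<subseteq> B'" "vec.independent B'" "UNIV \<subseteq> vec.span B'"
    using vec.maximal_independent_subset_extend[OF subset_UNIV B(2)] by metis
  have fin: "finite B'" using B'(2) by (rule vec.finiteI_independent)
  have "card B' = CARD('m)"
    using vec.basis_card_eq_dim[OF subset_UNIV B'(3,2)] by (simp add: card_cart_basis)
  then have card_diff: "card (B' - B) + card B = CARD('m)"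
    using card_Diff_subset[OF B(1) B'(1)] card_mono[OF fin B'(1)] by simp
  have "hermitian_perp q B \<inter> hermitian_perp q (B' - B) = hermitian_perp q B'"
    using B'(1) by (auto simp: hermitian_perp_def)
  also have "\<dots> = hermitian_perp q (vec.span B')"
    by (simp add: hermitian_perp_span assms)
  also have "\<dots> = {0}"
    using B'(3) hermitian_perp_UNIV[OF assms(1)] by (simp add: top.extremum_unique)
  finally have "vec.dim (hermitian_perp q B) + vec.dim (hermitian_perp q (B' - B)) \<le> CARD('m)"
    by (intro dim_sum_le_CARD subspace_hermitian_perp) simp
  moreover have "hermitian_perp q B = hermitian_perp q U"
    using B(3) hermitian_perp_span assms(1,2) by metis
  ultimately show ?thesis
    using dim_hermitian_perp_ge[OF B(1), of q] dim_hermitian_perp_ge[of "B' - B" q]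
      card_diff fin B(4) by simp
qed

section \<open>Totally isotropic subspaces\<close>

text \<open>Otherwise \<open>c * X ^ q + d * X\<close> would be a polynomial of degree
  \<open>q\<close> with all elements of the field as roots, more than \<open>q\<close> of
  them.\<close>

lemma semilinear_identity_imp_zero:
  fixes c d :: "'k::{field,finite}"
  assumes "\<And>a. a ^ q * c + a * d = 0" and "1 < q" and "q < CARD('k)"
  shows "c = 0"
proof (rule ccontr)
  assume "c \<noteq> 0"
  define f where "f = Polynomial.monom c q + Polynomial.monom d 1"
  have "Polynomial.coeff f q \<noteq> 0"
    using \<open>c \<noteq> 0\<close> assms(2) by (simp add: f_def)
  then have "f \<noteq> 0" by auto
  then have "card {x. poly f x = 0} \<le> Polynomial.degree f"
    by (rule card_poly_roots_bound)
  moreover have "{x. poly f x = 0} = UNIV"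
    using assms(1) by (simp add: f_def poly_monom mult.commute)
  moreover have "Polynomial.degree f \<le> q"
    unfolding f_def using assms(2)
    by (intro Polynomial.degree_add_le) (auto intro: order_trans[OF Polynomial.degree_monom_le])
  ultimately show False using assms(3) by simp
qed

text \<open>Polarization: expanding the form on the diagonal at \<open>x + a *s y\<close> leaves
  only the two mixed terms, and letting \<open>a\<close> run over the field separates them.\<close>

lemma totally_isotropic_imp_subset_perp:
  fixes M :: "('k::{field,finite} ^ 'm::finite) set"
  assumes "1 < q" and "q < CARD('k)" and add: "\<And>a b :: 'k. (a + b) ^ q = a ^ q + b ^ q"
    and "vec.subspace M" and isotropic: "\<And>x. x \<in> M \<Longrightarrow> hermitian_form q x x = 0"
  shows "M \<subseteq> hermitian_perp q M"
proof -
  have "hermitian_form q x y = 0" if "x \<in> M" and "y \<in> M" for x y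
  proof (rule semilinear_identity_imp_zero[OF _ assms(1,2)])
    fix a
    have "x + a *s y \<in> M"
      using that assms(4) by (simp add: vec.subspace_add vec.subspace_scale)
    then have "hermitian_form q (x + a *s y) (x + a *s y) = 0"
      by (rule isotropic)
    then show "a ^ q * hermitian_form q x y + a * hermitian_form q y x = 0"
      using isotropic that
      by (simp add: hermitian_form_add_left hermitian_form_scale_left
          hermitian_form_add_right[OF add] hermitian_form_scale_right algebra_simps)
  qed
  then show ?thesis by (auto simp: hermitian_perp_def)
qed

lemma dim_Int_hermitian_perp:
  fixes M U :: "('k::{field,finite} ^ 'm::finite) set"
  assumes "q > 0" and "\<And>a b :: 'k. (a + b) ^ q = a ^ q + b ^ q"
    and M: "vec.subspace M" "M \<subseteq> hermitian_perp q M" "2 * vec.dim M = CARD('m)"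
    and U: "vec.subspace U" "vec.dim U = vec.dim M"
  shows "vec.dim (M \<inter> hermitian_perp q U) = vec.dim (M \<inter> U)"
proof -
  let ?S = "{x + y |x y. x \<in> M \<and> y \<in> U}"
  have "vec.dim (hermitian_perp q M) = vec.dim M"
    using dim_hermitian_perp[OF assms(1,2) M(1)] M(3) by simp
  then have M_perp: "hermitian_perp q M = M"
    using vec.subspace_dim_equal[OF M(1) subspace_hermitian_perp M(2)] by simp
  \<comment> \<open>This gives one inclusion of the equality below; additivity in the second
    argument gives the other.\<close>
  have "M \<union> U \<subseteq> ?S"
  proof -
    have "0 \<in> M" "0 \<in> U" using M(1) U(1) by (auto intro: vec.subspace_0)
    then show ?thesis by (force intro: exI[of _ 0])
  qed
  then have "hermitian_perp q ?S = hermitian_perp q M \<inter> hermitian_perp q U"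
    by (fastforce simp: hermitian_perp_def hermitian_form_add_right assms(2))
  then have "vec.dim (M \<inter> hermitian_perp q U) + vec.dim ?S = CARD('m)"
    using dim_hermitian_perp[OF assms(1,2) vec.subspace_sums[OF M(1) U(1)]] M_perp by simp
  then show ?thesis
    using vec.dim_sums_Int[OF M(1) U(1)] M(3) U(2) by simp
qed

section \<open>From linear subspaces to sets of projective points\<close>

lemma span_singleton_in_pg_points: "x \<noteq> 0 \<Longrightarrow> vec.span {x} \<in> pg_points"
  by (simp add: pg_points_def)

lemma points_on_Int: "points_on S \<inter> points_on T = points_on (S \<inter> T)"
  by (auto simp: points_on_def)

text \<open>A linear isomorphism from \<open>S\<close> onto \<open>T\<close> maps the points of
  \<open>S\<close> injectively to points of \<open>T\<close>.\<close>

lemma card_points_on_le: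
  fixes S T :: "('k::{field,finite} ^ 'm::finite) set"
  assumes "vec.subspace S" and "vec.subspace T" and "vec.dim S = vec.dim T"
  shows "card (points_on S) \<le> card (points_on T)"
proof -
  obtain f where f: "Vector_Spaces.linear (*s) (*s) f" "f ` S = T" "inj_on f S"
    using vec.subspace_isomorphism[OF assms] by blast
  show ?thesis
  proof (rule card_inj_on_le)
    show "inj_on ((`) f) (points_on S)"
      using inj_on_image_Pow[OF f(3)] by (rule inj_on_subset) (auto simp: points_on_def)
    show "(`) f ` points_on S \<subseteq> points_on T"
    proof
      fix Q assume "Q \<in> (`) f ` points_on S"
      then obtain P where P: "Q = f ` P" "vec.subspace P" "vec.dim P = 1" "P \<subseteq> S"
        by (auto simp: points_on_def pg_points_def)
      have "inj_on f (vec.span P)"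
        using inj_on_subset[OF f(3) P(4)] P(2) by (metis vec.span_eq_iff)
      then have "vec.dim Q = 1"
        using vec.dim_image_eq[OF f(1)] P by simp
      moreover have "vec.subspace Q"
        using vec.linear_subspace_image[OF f(1) P(2)] P(1) by simp
      ultimately show "Q \<in> points_on T"
        using P f(2) by (auto simp: points_on_def pg_points_def)
    qed
  qed simp
qed

lemma card_points_on_cong:
  fixes S T :: "('k::{field,finite} ^ 'm::finite) set"
  assumes "vec.subspace S" and "vec.subspace T" and "vec.dim S = vec.dim T"
  shows "card (points_on S) = card (points_on T)"
  using card_points_on_le[of S T] card_points_on_le[of T S] assms by simp

text \<open>Each nonzero vector of \<open>U\<close> lies on the point that it spans, so
  orthogonality to all points on \<open>U\<close> is orthogonality to all vectors of
  \<open>U\<close>.\<close>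

lemma hermitian_polarity_points_on:
  fixes U :: "('k::{field,finite} ^ 'm::finite) set"
  assumes "q > 0" and "vec.subspace U"
  shows "hermitian_polarity q (points_on U) = points_on (hermitian_perp q U)"
proof -
  have "(\<forall>Q\<in>points_on U. \<forall>y\<in>Q. hermitian_form q x y = 0) \<longleftrightarrow> x \<in> hermitian_perp q U" for x
  proof
    assume *: "\<forall>Q\<in>points_on U. \<forall>y\<in>Q. hermitian_form q x y = 0"
    have "hermitian_form q x y = 0" if "y \<in> U" for y
    proof (cases "y = 0")
      case True
      then show ?thesis using assms(1) by (simp add: hermitian_form_zero_right)
    next
      case False
      then have "vec.span {y} \<in> points_on U"
        using that assms(2)
        by (simp add: points_on_def span_singleton_in_pg_points vec.span_minimal)
      then show ?thesis using * vec.span_base by blast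
    qed
    then show "x \<in> hermitian_perp q U" by (simp add: hermitian_perp_def)
  qed (auto simp: hermitian_perp_def points_on_def)
  then show ?thesis
    unfolding hermitian_polarity_def hermitian_form_def[symmetric]
      points_on_def[of "hermitian_perp q U"]
    by blast
qed

lemma isotropic_if_points_on_variety:
  fixes M :: "('k::{field,finite} ^ 'm::finite) set"
  assumes "vec.subspace M" and "points_on M \<subseteq> hermitian_variety q" and "x \<in> M"
  shows "hermitian_form q x x = 0"
proof (cases "x = 0")
  case False
  then have "vec.span {x} \<in> points_on M"
    using assms by (simp add: points_on_def span_singleton_in_pg_points vec.span_minimal)
  then have "vec.span {x} \<in> hermitian_variety q" using assms(2) by blast
  moreover have "x \<in> vec.span {x}" by (simp add: vec.span_base)
  ultimately show ?thesis
    by (auto simp: hermitian_variety_def hermitian_form_def)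
qed simp

text \<open>Cutting \<open>S\<close> down to the variety loses no point of \<open>\<mu>\<close>, so
  the sum counts the common points.\<close>

lemma sum_incidence_vector:
  fixes \<mu> S :: "('k::{field,finite} ^ 'm::finite) set set"
  assumes "\<mu> \<subseteq> hermitian_variety q"
  shows "(\<Sum>P\<in>\<mu>. incidence_vector q S P :: 'f::{field,finite}) = of_nat (card (\<mu> \<inter> S))"
proof -
  have "\<mu> \<inter> {P \<in> S. P \<in> hermitian_variety q} = \<mu> \<inter> S" using assms by blast
  then show ?thesis
    unfolding incidence_vector_def indicator_def by (simp flip: sum.inter_restrict)
qed

theorem theorem2p4:
  fixes p e q n :: nat
    and \<pi> :: "('k::{field,finite} ^ 'm::finite) set set"
    and \<alpha> :: "'f::{field,finite}"
  assumes "prime p" and "e \<ge> 1" and "q = p ^ e"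
    and "CARD('k) = q ^ 2"
    and "CARD('f) = p"
    and "CARD('m) = 2 * n + 2"
    and "\<pi> \<in> pg_subspaces n"
  shows "(\<lambda>P. \<alpha> * (incidence_vector q \<pi> P - incidence_vector q (hermitian_polarity q \<pi>) P))
           \<in> hermitian_dual_code n q"
proof -
  have "1 < q"
    using one_less_power[OF prime_gt_1_nat[OF assms(1)], of e] assms(2,3) by simp
  then have "0 < q" and "q < CARD('k)"
    by (simp_all add: assms(4) power2_eq_square)
  \<comment> \<open>Written as a power of \<open>p\<close>, the order of the field fits
    \<open>frobenius_power_add\<close>.\<close>
  have "CARD('k) = p ^ (e * 2)"
    by (simp add: assms(3,4) power_mult)
  then have add: "(a + b) ^ q = a ^ q + b ^ q" for a b :: 'k
    using frobenius_power_add assms(1,3) by blast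
  obtain U where U: "\<pi> = points_on U" "vec.subspace U" "vec.dim U = n + 1"
    using assms(7) by (auto simp: pg_subspaces_def points_on_def)
  have polar: "hermitian_polarity q \<pi> = points_on (hermitian_perp q U)"
    using hermitian_polarity_points_on[OF \<open>0 < q\<close> U(2)] U(1) by simp
  have "(\<Sum>P\<in>\<mu>. \<alpha> * (incidence_vector q \<pi> P - incidence_vector q (hermitian_polarity q \<pi>) P)) = 0"
    if generator: "\<mu> \<in> hermitian_generators n q" for \<mu>
  proof -
    obtain M where M: "\<mu> = points_on M" "vec.subspace M" "vec.dim M = n + 1"
      and sub: "points_on M \<subseteq> hermitian_variety q"
      using generator by (auto simp: hermitian_generators_def pg_subspaces_def points_on_def)
    have "M \<subseteq> hermitian_perp q M"
      using totally_isotropic_imp_subset_perp[OF \<open>1 < q\<close> \<open>q < CARD('k)\<close> add M(2)]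
        isotropic_if_points_on_variety[OF M(2) sub] by blast
    then have "vec.dim (M \<inter> hermitian_perp q U) = vec.dim (M \<inter> U)"
      using M(2,3) U(2,3) assms(6) by (intro dim_Int_hermitian_perp \<open>0 < q\<close> add) auto
    then have "card (\<mu> \<inter> hermitian_polarity q \<pi>) = card (\<mu> \<inter> \<pi>)"
      unfolding polar unfolding M(1) U(1) points_on_Int
      by (intro card_points_on_cong vec.subspace_inter subspace_hermitian_perp M(2) U(2))
    \<comment> \<open>The two counts agree as natural numbers, so their images in \<open>'f\<close>
      cancel.\<close>
    then show ?thesis
      using sub M(1)
      by (simp add: sum_incidence_vector sum_subtractf flip: sum_distrib_left)
  qed
  \<comment> \<open>The code also demands zeros off the variety, where both incidence vectors
    vanish.\<close>
  then show ?thesis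
    by (simp add: hermitian_dual_code_def incidence_vector_def)
qed

end
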